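(* Let $\mathtt{c},\mathtt{p}$ be real numbers with $0<\mathtt{c}<\mathtt{p}$, let $\Xi=\mathbb{R}$, $N=1$, and let $\zeta$ denote the single sample point in $\Xi$. For $r\in\{1,2\}$ and $\epsilon>0$, consider the distributionally robust newsvendor problem $$\min_{x\ge0}\ (\mathtt{c}-\mathtt{p})x+\sup_{\mathbb{P}\in\mathcal{P}^r_{1,\epsilon}}\mathbb{E}_{\mathbb{P}}[Z(x,\tilde\xi)],\qquad Z(x,\xi)=\mathtt{p}\max\{x+\xi,0\}.$$ For any $\epsilon\in(0,\infty)$, the optimal solution to this problem when $r=1$ and $r=2$ is, respectively, $$x^1_1(\epsilon)=-\zeta,\qquad x^2_1(\epsilon)=\max\left\{0,\,-\zeta-\frac{\epsilon}{2}\sqrt{\frac{\mathtt{p}}{\mathtt{p}-\mathtt{c}}}\right\}.$$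
   Context: Here $\mathtt{c}$ is the unit cost per newspaper, $\mathtt{p}$ the unit selling price, $x$ the number of newspapers to order, and $\tilde\xi$ the negative of the uncertain demand, supported on $\Xi=\mathbb{R}$, for which the single sample $\zeta$ is observed. For $r\in\{1,2\}$, $\mathcal{P}^r_{1,\epsilon}$ is the set of Borel probability measures $\mathbb{Q}$ on $\mathbb{R}$ with finite $r$th moment and $W^r(\mathbb{Q},\delta_\zeta)\le\epsilon$, where $\delta_\zeta$ is the Dirac measure at $\zeta$ (the empirical distribution for $N=1$) and $W^r(\mathbb{Q}_1,\mathbb{Q}_2)=\inf_\gamma\big(\int_{\mathbb{R}\times\mathbb{R}}|\xi_1-\xi_2|^r\,d\gamma(\xi_1,\xi_2)\big)^{1/r}$, with $\gamma$ ranging over probability measures on $\mathbb{R}\times\mathbb{R}$ with marginals $\mathbb{Q}_1$ and $\mathbb{Q}_2$, is the $r$-Wasserstein distance. $\mathbb{E}_{\mathbb{P}}$ denotes expectation with $\tilde\xi\sim\mathbb{P}$. The notation $x^r_1(\epsilon)$ denotes the optimal solution of the problem for the given $r$ and $\epsilon$, with $N=1$.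
   Formalization: The formula x = −ζ for r = 1 is stated only for ζ ≤ 0 (nonnegative observed demand); for ζ > 0 the point −ζ violates x ≥ 0 and the optimal solution is 0. The r = 2 formula is stated for every real ζ. *)

theory Defs
  imports "HOL-Probability.Probability"
begin

definition couplings :: "real measure \<Rightarrow> real measure \<Rightarrow> (real \<times> real) measure set" where
  "couplings Q1 Q2 =
     {\<gamma>. prob_space \<gamma> \<and> sets \<gamma> = sets (borel \<Otimes>\<^sub>M borel) \<and>
         distr \<gamma> borel fst = Q1 \<and> distr \<gamma> borel snd = Q2}"

definition ennroot :: "nat \<Rightarrow> ennreal \<Rightarrow> ennreal" where
  "ennroot r a = (if a = top then top else ennreal (root r (enn2real a)))"

definition wasserstein :: "nat \<Rightarrow> real measure \<Rightarrow> real measure \<Rightarrow> ennreal" where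
  "wasserstein r Q1 Q2 =
     (INF \<gamma>\<in>couplings Q1 Q2. ennroot r (\<integral>\<^sup>+ (\<xi>1, \<xi>2). ennreal (\<bar>\<xi>1 - \<xi>2\<bar> ^ r) \<partial>\<gamma>))"

definition wasserstein_ball :: "nat \<Rightarrow> real measure \<Rightarrow> real \<Rightarrow> real measure set" where
  "wasserstein_ball r P0 \<epsilon> =
     {Q. prob_space Q \<and> sets Q = sets borel \<and> integrable Q (\<lambda>\<xi>. \<bar>\<xi>\<bar> ^ r) \<and>
         wasserstein r Q P0 \<le> ennreal \<epsilon>}"

definition newsvendor_Z :: "real \<Rightarrow> real \<Rightarrow> real \<Rightarrow> real" where
  "newsvendor_Z p x \<xi> = p * max (x + \<xi>) 0"

(* The supremum is taken in ereal because a supremum of an unbounded set of reals is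
   unspecified.  For r \<ge> 1 the integrand is integrable for every measure in the ball,
   so the Bochner integral is the true expectation. *)
definition newsvendor_objective ::
    "real \<Rightarrow> real \<Rightarrow> nat \<Rightarrow> real \<Rightarrow> real \<Rightarrow> real \<Rightarrow> ereal" where
  "newsvendor_objective c p r \<epsilon> \<zeta> x =
     ereal ((c - p) * x) +
     (SUP P\<in>wasserstein_ball r (return borel \<zeta>) \<epsilon>. ereal (\<integral>\<xi>. newsvendor_Z p x \<xi> \<partial>P))"

definition newsvendor_solutions :: "real \<Rightarrow> real \<Rightarrow> nat \<Rightarrow> real \<Rightarrow> real \<Rightarrow> real set" where
  "newsvendor_solutions c p r \<epsilon> \<zeta> =
     {x. is_arg_min (newsvendor_objective c p r \<epsilon> \<zeta>) (\<lambda>x. 0 \<le> x) x}"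

end

theory Submission
  imports Defs
begin

text \<open>
  Write \<open>a = x + \<zeta>\<close> for the order measured from the observed demand. A coupling with a Dirac
  measure is unique, so the ambiguity ball consists of the laws whose \<open>r\<close>-th absolute moment
  about \<open>\<zeta>\<close> is at most \<open>\<epsilon> ^ r\<close> (\<open>wasserstein_return\<close>, \<open>wasserstein_ball_return\<close>), and the inner
  problem is a one-constraint moment problem.

  The worst laws are of a simple kind: with probability \<open>k ^ r\<close> the outcome moves from \<open>\<zeta>\<close> upwards
  by \<open>\<epsilon> / k\<close>, which spends the moment budget exactly. They make the worst-case expectation of
  \<open>p * max (x + \<xi>) 0\<close> at least \<open>p * (k ^ r * a + k ^ (r - 1) * \<epsilon>)\<close> for every \<open>k\<close> in \<open>(0, 1]\<close>
  (\<open>worst_case_ge\<close>). Weak duality bounds it from above: if \<open>max (a + y) 0 \<le> C + l * \<bar>y\<bar> ^ r\<close> for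
  all \<open>y\<close>, then the worst case is at most \<open>p * (C + l * \<epsilon> ^ r)\<close> (\<open>worst_case_le\<close>). Suitable
  multipliers close the gap, and the worst case is \<open>p * (max a 0 + \<epsilon>)\<close> for \<open>r = 1\<close> and
  \<open>p * scarf \<epsilon> a\<close> for \<open>r = 2\<close>, where \<open>scarf \<epsilon> a\<close> is the maximum of \<open>k * \<epsilon> + k\<^sup>2 * a\<close> over
  \<open>k \<in> (0, 1]\<close>.

  What remains is one-dimensional convex minimisation. For \<open>r = 1\<close> the slope of the objective jumps
  from \<open>c - p < 0\<close> to \<open>c > 0\<close> at \<open>a = 0\<close>, a feasible order if \<open>\<zeta> \<le> 0\<close>. For
  \<open>r = 2\<close> the lines \<open>k * \<epsilon> + k\<^sup>2 * a\<close> are the tangents of \<open>scarf \<epsilon>\<close>, so the objective is stationary where the tangent has slope \<open>k\<^sup>2 = (p - c) / p\<close>, which is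
  at \<open>a = - \<epsilon> / (2 * k)\<close>; if that order is negative, the objective increases on all of \<open>x \<ge> 0\<close>.
\<close>

section \<open>The Wasserstein ball around a Dirac measure\<close>

lemma ennroot_le_iff:
  assumes "0 < r" "0 \<le> \<epsilon>"
  shows "ennroot r I \<le> ennreal \<epsilon> \<longleftrightarrow> I \<le> ennreal (\<epsilon> ^ r)"
proof (cases I)
  case (real t)
  have "root r t \<le> \<epsilon> \<longleftrightarrow> t \<le> \<epsilon> ^ r"
    using assms real by (metis real_root_le_iff real_root_power_cancel)
  then show ?thesis
    using assms real by (simp add: ennroot_def)
next
  case top
  then show ?thesis
    by (simp add: ennroot_def top_unique)
qed

text \<open>The second coordinate of such a coupling equals \<open>\<zeta>\<close> almost surely, so the transport cost is
  a function of the first marginal alone.\<close>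

lemma coupling_return_cost:
  assumes "\<gamma> \<in> couplings Q (return borel \<zeta>)"
  shows "(\<integral>\<^sup>+ (\<xi>1, \<xi>2). ennreal (\<bar>\<xi>1 - \<xi>2\<bar> ^ r) \<partial>\<gamma>) = (\<integral>\<^sup>+ \<xi>. ennreal (\<bar>\<xi> - \<zeta>\<bar> ^ r) \<partial>Q)"
proof -
  have sets_\<gamma> [measurable_cong]: "sets \<gamma> = sets (borel \<Otimes>\<^sub>M borel)"
    and marg1: "distr \<gamma> borel fst = Q" and marg2: "distr \<gamma> borel snd = return borel \<zeta>"
    using assms by (auto simp: couplings_def)
  have fst_m: "fst \<in> measurable \<gamma> borel" and snd_m: "snd \<in> measurable \<gamma> borel"
    by measurable
  have "AE y in return borel \<zeta>. y = \<zeta>"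
    by (subst AE_return) auto
  then have "AE y in distr \<gamma> borel snd. y = \<zeta>"
    unfolding marg2 .
  then have "AE z in \<gamma>. snd z = \<zeta>"
    by (subst (asm) AE_distr_iff[OF snd_m]) auto
  then have "(\<integral>\<^sup>+ (\<xi>1, \<xi>2). ennreal (\<bar>\<xi>1 - \<xi>2\<bar> ^ r) \<partial>\<gamma>) = (\<integral>\<^sup>+ z. ennreal (\<bar>fst z - \<zeta>\<bar> ^ r) \<partial>\<gamma>)"
    by (intro nn_integral_cong_AE) (auto simp: case_prod_beta)
  also have "\<dots> = (\<integral>\<^sup>+ \<xi>. ennreal (\<bar>\<xi> - \<zeta>\<bar> ^ r) \<partial>distr \<gamma> borel fst)"
    by (subst nn_integral_distr[OF fst_m]) auto
  finally show ?thesis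
    by (simp add: marg1)
qed

lemma couplings_return_nonempty:
  assumes "prob_space Q" and sets_Q [measurable_cong]: "sets Q = sets borel"
  shows "distr Q (borel \<Otimes>\<^sub>M borel) (\<lambda>\<xi>. (\<xi>, \<zeta>)) \<in> couplings Q (return borel \<zeta>)"
proof -
  interpret prob_space Q by fact
  have pair_m: "(\<lambda>\<xi>. (\<xi>, \<zeta>)) \<in> measurable Q (borel \<Otimes>\<^sub>M borel)"
    by measurable
  have "distr Q borel (\<lambda>\<xi>. \<xi>) = Q"
    using distr_id2[of borel Q] sets_Q by simp
  moreover have "distr Q borel (\<lambda>\<xi>. \<zeta>) = return borel \<zeta>"
    by (rule distr_const) auto
  ultimately show ?thesis
    using prob_space_distr[OF pair_m] pair_m
    by (auto simp: couplings_def distr_distr comp_def)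
qed

lemma wasserstein_return:
  assumes "prob_space Q" "sets Q = sets borel"
  shows "wasserstein r Q (return borel \<zeta>) = ennroot r (\<integral>\<^sup>+ \<xi>. ennreal (\<bar>\<xi> - \<zeta>\<bar> ^ r) \<partial>Q)"
proof -
  have "couplings Q (return borel \<zeta>) \<noteq> {}"
    using couplings_return_nonempty[OF assms] by blast
  then show ?thesis
    unfolding wasserstein_def by (simp add: coupling_return_cost cong: INF_cong)
qed

lemma wasserstein_ball_return:
  assumes "0 < r" "0 \<le> \<epsilon>"
  shows "Q \<in> wasserstein_ball r (return borel \<zeta>) \<epsilon> \<longleftrightarrow>
    prob_space Q \<and> sets Q = sets borel \<and> integrable Q (\<lambda>\<xi>. \<bar>\<xi>\<bar> ^ r) \<and>
    (\<integral>\<^sup>+ \<xi>. ennreal (\<bar>\<xi> - \<zeta>\<bar> ^ r) \<partial>Q) \<le> ennreal (\<epsilon> ^ r)"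
  by (auto simp: wasserstein_ball_def wasserstein_return ennroot_le_iff[OF assms])

section \<open>Bounds on the worst-case expectation\<close>

text \<open>Weak duality for the moment constraint, with multiplier \<open>l\<close>: integrate the pointwise bound.\<close>

lemma worst_case_le:
  assumes r: "0 < r" and \<epsilon>: "0 \<le> \<epsilon>" and p: "0 \<le> p" and l: "0 \<le> l"
    and bound: "\<And>y. max (x + \<zeta> + y) 0 \<le> C + l * \<bar>y\<bar> ^ r"
  shows "(SUP P\<in>wasserstein_ball r (return borel \<zeta>) \<epsilon>. ereal (\<integral>\<xi>. newsvendor_Z p x \<xi> \<partial>P))
    \<le> ereal (p * (C + l * \<epsilon> ^ r))"
proof (rule SUP_least)
  fix Q assume "Q \<in> wasserstein_ball r (return borel \<zeta>) \<epsilon>"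
  then have Q: "prob_space Q" and sets_Q [measurable_cong]: "sets Q = sets borel"
    and moment: "(\<integral>\<^sup>+ \<xi>. ennreal (\<bar>\<xi> - \<zeta>\<bar> ^ r) \<partial>Q) \<le> ennreal (\<epsilon> ^ r)"
    by (auto simp: wasserstein_ball_return[OF r \<epsilon>])
  interpret prob_space Q by (rule Q)
  have int: "integrable Q (\<lambda>\<xi>. \<bar>\<xi> - \<zeta>\<bar> ^ r)"
    using moment by (intro integrableI_nonneg) (auto intro: le_less_trans)
  have "ennreal (\<integral>\<xi>. \<bar>\<xi> - \<zeta>\<bar> ^ r \<partial>Q) \<le> ennreal (\<epsilon> ^ r)"
    using moment by (subst nn_integral_eq_integral[symmetric, OF int]) auto
  then have le: "(\<integral>\<xi>. \<bar>\<xi> - \<zeta>\<bar> ^ r \<partial>Q) \<le> \<epsilon> ^ r"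
    using \<epsilon> by simp
  have Z_le: "newsvendor_Z p x \<xi> \<le> p * (C + l * \<bar>\<xi> - \<zeta>\<bar> ^ r)" for \<xi>
    using bound[of "\<xi> - \<zeta>"] p by (auto simp: newsvendor_Z_def intro!: mult_left_mono)
  have Z_nonneg: "0 \<le> newsvendor_Z p x \<xi>" for \<xi>
    using p by (simp add: newsvendor_Z_def)
  have "(\<integral>\<xi>. newsvendor_Z p x \<xi> \<partial>Q) \<le> (\<integral>\<xi>. p * (C + l * \<bar>\<xi> - \<zeta>\<bar> ^ r) \<partial>Q)"
    using int Z_le order_trans[OF Z_nonneg Z_le] by (intro integral_mono') auto
  also have "\<dots> = p * (C + l * (\<integral>\<xi>. \<bar>\<xi> - \<zeta>\<bar> ^ r \<partial>Q))"
    using int by (simp add: prob_space)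
  also have "\<dots> \<le> p * (C + l * \<epsilon> ^ r)"
    using le p l by (intro mult_left_mono add_left_mono) auto
  finally show "ereal (\<integral>\<xi>. newsvendor_Z p x \<xi> \<partial>Q) \<le> ereal (p * (C + l * \<epsilon> ^ r))"
    by simp
qed

text \<open>The witness puts mass \<open>k ^ r\<close> at \<open>\<zeta> + \<epsilon> / k\<close> and the rest at \<open>\<zeta>\<close>, so that its \<open>r\<close>-th moment
  about \<open>\<zeta>\<close> is exactly \<open>\<epsilon> ^ r\<close>. Only the payoff of the displaced mass enters the bound.\<close>

lemma worst_case_ge:
  assumes r: "0 < r" and \<epsilon>: "0 \<le> \<epsilon>" and p: "0 \<le> p" and k: "0 < k" "k \<le> 1"
  shows "ereal (p * (k ^ r * (x + \<zeta>) + k ^ (r - 1) * \<epsilon>))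
    \<le> (SUP P\<in>wasserstein_ball r (return borel \<zeta>) \<epsilon>. ereal (\<integral>\<xi>. newsvendor_Z p x \<xi> \<partial>P))"
proof -
  define B where "B = bernoulli_pmf (k ^ r)"
  define v where "v b = (if b then \<zeta> + \<epsilon> / k else \<zeta>)" for b
  define Q where "Q = distr (measure_pmf B) borel v"
  have q: "0 \<le> k ^ r" "k ^ r \<le> 1"
    using k by (auto simp: power_le_one)
  have integral_Q: "(\<integral>\<xi>. f \<xi> \<partial>Q) = k ^ r * f (\<zeta> + \<epsilon> / k) + (1 - k ^ r) * f \<zeta>"
    if [measurable]: "f \<in> borel_measurable borel" for f :: "real \<Rightarrow> real"
    using q by (simp add: Q_def B_def v_def integral_distr)
  have integrable_Q: "integrable Q f"
    if [measurable]: "f \<in> borel_measurable borel" for f :: "real \<Rightarrow> real"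
    unfolding Q_def by (subst integrable_distr_eq) (auto intro!: integrable_measure_pmf_finite)
  have "(\<integral>\<xi>. \<bar>\<xi> - \<zeta>\<bar> ^ r \<partial>Q) = \<epsilon> ^ r"
    using r \<epsilon> k by (subst integral_Q) (auto simp: power_divide zero_power)
  then have "(\<integral>\<^sup>+ \<xi>. ennreal (\<bar>\<xi> - \<zeta>\<bar> ^ r) \<partial>Q) = ennreal (\<epsilon> ^ r)"
    by (subst nn_integral_eq_integral) (auto intro!: integrable_Q)
  moreover have "prob_space Q"
    unfolding Q_def by (rule prob_space.prob_space_distr) (auto simp: prob_space_measure_pmf)
  ultimately have ball: "Q \<in> wasserstein_ball r (return borel \<zeta>) \<epsilon>"
    by (auto simp: wasserstein_ball_return[OF r \<epsilon>] Q_def intro!: integrable_Q[unfolded Q_def])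
  have [measurable]: "newsvendor_Z p x \<in> borel_measurable borel"
    unfolding newsvendor_Z_def by measurable
  have "k ^ r * (\<epsilon> / k) = k ^ (r - 1) * \<epsilon>"
    using r k by (cases r) auto
  then have "p * (k ^ r * (x + \<zeta>) + k ^ (r - 1) * \<epsilon>) = p * (k ^ r * (x + \<zeta>) + k ^ r * (\<epsilon> / k))"
    by simp
  also have "\<dots> = k ^ r * (p * (x + (\<zeta> + \<epsilon> / k)))"
    by (simp add: algebra_simps)
  also have "\<dots> \<le> k ^ r * newsvendor_Z p x (\<zeta> + \<epsilon> / k)"
    using p q by (auto simp: newsvendor_Z_def intro!: mult_left_mono)
  also have "\<dots> \<le> (\<integral>\<xi>. newsvendor_Z p x \<xi> \<partial>Q)"
    using p q by (subst integral_Q) (auto simp: newsvendor_Z_def)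
  finally show ?thesis
    using ball by (intro SUP_upper2) auto
qed

section \<open>The objective in closed form\<close>

text \<open>The multiplier is the Lipschitz constant \<open>1\<close> of \<open>max (a + y) 0\<close> in \<open>y\<close>. If
  \<open>x + \<zeta> < 0\<close> and \<open>\<epsilon>\<close> and \<open>p\<close> are positive, no law attains the supremum: it is approached as \<open>k\<close>
  tends to \<open>0\<close>, by ever smaller masses moved ever further.\<close>

lemma newsvendor_objective_1:
  assumes \<epsilon>: "0 \<le> \<epsilon>" and p: "0 \<le> p"
  shows "newsvendor_objective c p 1 \<epsilon> \<zeta> x = ereal ((c - p) * x + p * (max (x + \<zeta>) 0 + \<epsilon>))"
proof -
  define S where
    "S = (SUP P\<in>wasserstein_ball 1 (return borel \<zeta>) \<epsilon>. ereal (\<integral>\<xi>. newsvendor_Z p x \<xi> \<partial>P))"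
  have "S \<le> ereal (p * (max (x + \<zeta>) 0 + 1 * \<epsilon> ^ 1))"
    unfolding S_def using \<epsilon> p by (intro worst_case_le) auto
  moreover have lower: "ereal (p * (k * (x + \<zeta>) + \<epsilon>)) \<le> S" if "0 < k" "k \<le> 1" for k
    using worst_case_ge[of 1 \<epsilon> p k x \<zeta>] that \<epsilon> p by (simp add: S_def)
  have "ereal (p * (max (x + \<zeta>) 0 + \<epsilon>)) \<le> S"
  proof (cases "0 \<le> x + \<zeta>")
    case True
    then show ?thesis
      using lower[of 1] by (simp add: max_def)
  next
    case False
    have "((\<lambda>k. ereal (p * (k * (x + \<zeta>) + \<epsilon>))) \<longlongrightarrow> ereal (p * (0 * (x + \<zeta>) + \<epsilon>))) (at_right 0)"
      by (intro tendsto_intros)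
    moreover have "\<forall>\<^sub>F k in at_right 0. ereal (p * (k * (x + \<zeta>) + \<epsilon>)) \<le> S"
      unfolding eventually_at_right_field by (intro exI[of _ 1]) (auto intro: lower)
    ultimately have "ereal (p * (0 * (x + \<zeta>) + \<epsilon>)) \<le> S"
      by (intro tendsto_upperbound) auto
    then show ?thesis
      using False by (simp add: max_def)
  qed
  ultimately have "S = ereal (p * (max (x + \<zeta>) 0 + \<epsilon>))"
    by (simp add: antisym)
  then show ?thesis
    by (simp add: newsvendor_objective_def S_def)
qed

text \<open>The largest value of \<open>E (max (a + Y) 0)\<close> under \<open>E (Y\<^sup>2) \<le> \<epsilon>\<^sup>2\<close>, a bound of Scarf's type with the
  mean left free. It is the upper envelope of the lines \<open>k * \<epsilon> + k\<^sup>2 * a\<close> for \<open>k\<close> in \<open>(0, 1]\<close>: the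
  maximiser is \<open>k = - \<epsilon> / (2 * a)\<close> if \<open>a \<le> - \<epsilon> / 2\<close>, and the end point \<open>k = 1\<close> otherwise.\<close>

definition scarf :: "real \<Rightarrow> real \<Rightarrow> real" where
  "scarf \<epsilon> a = (if a \<le> - \<epsilon> / 2 then \<epsilon>\<^sup>2 / (- 4 * a) else a + \<epsilon>)"

lemma scarf_touches_tangent:
  assumes "0 < \<epsilon>" "0 < k" "k \<le> 1"
  shows "scarf \<epsilon> (- \<epsilon> / (2 * k)) = k * \<epsilon> + k\<^sup>2 * (- \<epsilon> / (2 * k))"
proof -
  have "- \<epsilon> / (2 * k) \<le> - \<epsilon> / 2"
    using assms by (simp add: field_simps)
  then show ?thesis
    using assms by (simp add: scarf_def field_simps power2_eq_square)
qed

lemma scarf_ge_tangent: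
  assumes \<epsilon>: "0 < \<epsilon>" and k: "0 < k" "k \<le> 1"
  shows "k * \<epsilon> + k\<^sup>2 * a \<le> scarf \<epsilon> a"
proof (cases "a \<le> - \<epsilon> / 2")
  case True
  then have a: "a < 0" using \<epsilon> by simp
  have "scarf \<epsilon> a - (k * \<epsilon> + k\<^sup>2 * a) = (2 * k * a + \<epsilon>)\<^sup>2 / (- 4 * a)"
    using True a by (simp add: scarf_def field_simps power2_eq_square)
  also have "\<dots> \<ge> 0"
    using a by (intro divide_nonneg_nonneg) auto
  finally show ?thesis by simp
next
  case False
  have "(1 + k) * (- \<epsilon> / 2) \<le> (1 + k) * a"
    using False k by (intro mult_left_mono) auto
  moreover have "(1 + k) * \<epsilon> \<le> 2 * \<epsilon>"
    using \<epsilon> k by (intro mult_right_mono) auto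
  ultimately have "0 \<le> \<epsilon> + (1 + k) * a"
    by linarith
  then have "0 \<le> (1 - k) * (\<epsilon> + (1 + k) * a)"
    using k by simp
  then show ?thesis
    using False by (simp add: scarf_def algebra_simps power2_eq_square)
qed

text \<open>Strictness fails for \<open>k = 1\<close>, since that tangent agrees with \<open>scarf \<epsilon>\<close> on a half-line.\<close>

lemma scarf_gt_tangent:
  assumes \<epsilon>: "0 < \<epsilon>" and k: "0 < k" "k < 1" and a: "a \<noteq> - \<epsilon> / (2 * k)"
  shows "k * \<epsilon> + k\<^sup>2 * a < scarf \<epsilon> a"
proof (cases "a \<le> - \<epsilon> / 2")
  case True
  then have neg: "a < 0" using \<epsilon> by simp
  have "2 * k * a + \<epsilon> \<noteq> 0"
    using a k by (auto simp: field_simps)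
  then have "0 < (2 * k * a + \<epsilon>)\<^sup>2 / (- 4 * a)"
    using neg by (intro divide_pos_pos) auto
  also have "\<dots> = scarf \<epsilon> a - (k * \<epsilon> + k\<^sup>2 * a)"
    using True neg by (simp add: scarf_def field_simps power2_eq_square)
  finally show ?thesis by simp
next
  case False
  have "(1 + k) * (- \<epsilon> / 2) < (1 + k) * a"
    using False k by (intro mult_strict_left_mono) auto
  moreover have "(1 + k) * \<epsilon> \<le> 2 * \<epsilon>"
    using \<epsilon> k by (intro mult_right_mono) auto
  ultimately have "0 < \<epsilon> + (1 + k) * a"
    by linarith
  then have "0 < (1 - k) * (\<epsilon> + (1 + k) * a)"
    using k by simp
  then show ?thesis
    using False by (simp add: scarf_def algebra_simps power2_eq_square)
qed

text \<open>The parabola \<open>C + l * y\<^sup>2\<close> dominating \<open>max (a + y) 0\<close> has to touch it at the atoms of the optimal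
  two-point law. With both atoms present (\<open>a < - \<epsilon> / 2\<close>) this forces \<open>C = 0\<close> and
  \<open>l = - 1 / (4 * a)\<close>; with the single atom \<open>y = \<epsilon>\<close> it forces \<open>l = 1 / (2 * \<epsilon>)\<close> and
  \<open>C = a + \<epsilon> / 2\<close>.\<close>

lemma newsvendor_objective_2:
  assumes \<epsilon>: "0 < \<epsilon>" and p: "0 \<le> p"
  shows "newsvendor_objective c p 2 \<epsilon> \<zeta> x = ereal ((c - p) * x + p * scarf \<epsilon> (x + \<zeta>))"
proof -
  define a where "a = x + \<zeta>"
  define S where
    "S = (SUP P\<in>wasserstein_ball 2 (return borel \<zeta>) \<epsilon>. ereal (\<integral>\<xi>. newsvendor_Z p x \<xi> \<partial>P))"
  have upper: "S \<le> ereal (p * (C + l * \<epsilon>\<^sup>2))"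
    if "0 \<le> l" "\<And>y. max (a + y) 0 \<le> C + l * y\<^sup>2" for C l
    unfolding S_def using that \<epsilon> p by (intro worst_case_le) (auto simp: a_def)
  have lower: "ereal (p * (k * \<epsilon> + k\<^sup>2 * a)) \<le> S" if "0 < k" "k \<le> 1" for k
    using worst_case_ge[of 2 \<epsilon> p k x \<zeta>] that \<epsilon> p by (simp add: S_def a_def add.commute)
  have "S = ereal (p * scarf \<epsilon> a)"
  proof (cases "a \<le> - \<epsilon> / 2")
    case True
    then have a: "a < 0" using \<epsilon> by simp
    have "max (a + y) 0 \<le> 0 + (- 1 / (4 * a)) * y\<^sup>2" for y
    proof -
      have "(- 1 / (4 * a)) * y\<^sup>2 - (a + y) = (2 * a + y)\<^sup>2 / (- 4 * a)"
        using a by (simp add: field_simps power2_eq_square)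
      also have "\<dots> \<ge> 0"
        using a by (intro divide_nonneg_nonneg) auto
      finally have "a + y \<le> (- 1 / (4 * a)) * y\<^sup>2" by simp
      moreover have "0 \<le> (- 1 / (4 * a)) * y\<^sup>2"
        using a by (intro mult_nonneg_nonneg divide_nonpos_nonpos) auto
      ultimately show ?thesis by simp
    qed
    then have "S \<le> ereal (p * (0 + (- 1 / (4 * a)) * \<epsilon>\<^sup>2))"
      using a by (intro upper divide_nonpos_nonpos) auto
    then have "S \<le> ereal (p * scarf \<epsilon> a)"
      using True by (simp add: scarf_def)
    moreover have "- \<epsilon> / (2 * a) * \<epsilon> + (- \<epsilon> / (2 * a))\<^sup>2 * a = scarf \<epsilon> a"
      using True a by (simp add: scarf_def field_simps power2_eq_square)
    then have "ereal (p * scarf \<epsilon> a) \<le> S"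
      using lower[of "- \<epsilon> / (2 * a)"] True a \<epsilon> by (simp add: field_simps)
    ultimately show ?thesis by (rule antisym)
  next
    case False
    then have nonneg: "0 \<le> a + \<epsilon> / 2" by simp
    have "max (a + y) 0 \<le> (a + \<epsilon> / 2) + 1 / (2 * \<epsilon>) * y\<^sup>2" for y
    proof -
      have "(a + \<epsilon> / 2) + 1 / (2 * \<epsilon>) * y\<^sup>2 - (a + y) = (\<epsilon> - y)\<^sup>2 / (2 * \<epsilon>)"
        using \<epsilon> by (simp add: field_simps power2_eq_square)
      also have "\<dots> \<ge> 0"
        using \<epsilon> by simp
      finally have "a + y \<le> (a + \<epsilon> / 2) + 1 / (2 * \<epsilon>) * y\<^sup>2" by simp
      moreover have "0 \<le> (a + \<epsilon> / 2) + 1 / (2 * \<epsilon>) * y\<^sup>2"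
        using \<epsilon> by (intro add_nonneg_nonneg[OF nonneg]) auto
      ultimately show ?thesis by simp
    qed
    then have "S \<le> ereal (p * ((a + \<epsilon> / 2) + 1 / (2 * \<epsilon>) * \<epsilon>\<^sup>2))"
      using \<epsilon> by (intro upper) auto
    then have "S \<le> ereal (p * (a + \<epsilon>))"
      using \<epsilon> by (simp add: power2_eq_square add.commute)
    moreover have "ereal (p * (a + \<epsilon>)) \<le> S"
      using lower[of 1] by (simp add: add.commute)
    ultimately show ?thesis
      using False by (simp add: scarf_def antisym)
  qed
  then show ?thesis
    by (simp add: newsvendor_objective_def S_def a_def)
qed

section \<open>Minimisation over the order quantity\<close>

lemma newsvendor_solutions_eq_singleton:
  assumes "\<And>x. newsvendor_objective c p r \<epsilon> \<zeta> x = ereal (h x)"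
    and "0 \<le> x0" "\<And>x. 0 \<le> x \<Longrightarrow> x \<noteq> x0 \<Longrightarrow> h x0 < h x"
  shows "newsvendor_solutions c p r \<epsilon> \<zeta> = {x0}"
  using assms by (fastforce simp: newsvendor_solutions_def is_arg_min_def)

lemma newsvendor_solutions_1:
  assumes "0 < c" "c < p" "0 < \<epsilon>" "\<zeta> \<le> 0"
  shows "newsvendor_solutions c p 1 \<epsilon> \<zeta> = {- \<zeta>}"
proof (rule newsvendor_solutions_eq_singleton)
  show "newsvendor_objective c p 1 \<epsilon> \<zeta> x = ereal ((c - p) * x + p * (max (x + \<zeta>) 0 + \<epsilon>))" for x
    using assms by (intro newsvendor_objective_1) auto
next
  fix x assume "x \<noteq> - \<zeta>"
  then consider "x + \<zeta> < 0" | "0 < x + \<zeta>" by linarith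
  then show "(c - p) * - \<zeta> + p * (max (- \<zeta> + \<zeta>) 0 + \<epsilon>) < (c - p) * x + p * (max (x + \<zeta>) 0 + \<epsilon>)"
  proof cases
    case 1
    then have "0 < (c - p) * (x + \<zeta>)"
      using assms by (intro mult_neg_neg) auto
    then show ?thesis
      using 1 by (simp add: algebra_simps)
  next
    case 2
    then have "0 < c * (x + \<zeta>)"
      using assms by simp
    then show ?thesis
      using 2 by (simp add: algebra_simps)
  qed
qed (use assms in auto)

text \<open>The scaled objective \<open>scarf \<epsilon> a - k\<^sup>2 * a\<close> is smallest where the tangent of slope \<open>k\<^sup>2\<close> touches,
  uniquely so because \<open>k < 1\<close>. Right of that point \<open>scarf \<epsilon>\<close> has tangents with slope above \<open>k\<^sup>2\<close>, so
  the constrained minimum over \<open>[\<zeta>, \<infinity>)\<close> is at its left end.\<close>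

lemma scarf_constrained_minimum:
  assumes \<epsilon>: "0 < \<epsilon>" and k: "0 < k" "k < 1"
    and a: "\<zeta> \<le> a" "a \<noteq> max \<zeta> (- \<epsilon> / (2 * k))"
  shows "scarf \<epsilon> (max \<zeta> (- \<epsilon> / (2 * k))) - k\<^sup>2 * max \<zeta> (- \<epsilon> / (2 * k)) < scarf \<epsilon> a - k\<^sup>2 * a"
proof (cases "\<zeta> \<le> - \<epsilon> / (2 * k)")
  case True
  then have "a \<noteq> - \<epsilon> / (2 * k)"
    using a by (simp add: max_def)
  then have "k * \<epsilon> + k\<^sup>2 * a < scarf \<epsilon> a"
    by (rule scarf_gt_tangent[OF \<epsilon> k])
  moreover have "scarf \<epsilon> (- \<epsilon> / (2 * k)) = k * \<epsilon> + k\<^sup>2 * (- \<epsilon> / (2 * k))"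
    using \<epsilon> k by (intro scarf_touches_tangent) auto
  ultimately show ?thesis
    unfolding max_absorb2[OF True] by linarith
next
  case False
  then have less: "\<zeta> < a"
    using a by (simp add: max_def)
  \<comment> \<open>\<open>j\<^sup>2\<close> is the slope of \<open>scarf \<epsilon>\<close> at \<open>\<zeta>\<close>.\<close>
  define j where "j = (if \<zeta> \<le> - \<epsilon> / 2 then - \<epsilon> / (2 * \<zeta>) else 1)"
  have j: "k < j" "j \<le> 1"
    using False \<epsilon> k by (auto simp: j_def field_simps)
  have "scarf \<epsilon> \<zeta> = j * \<epsilon> + j\<^sup>2 * \<zeta>"
    using \<epsilon> by (auto simp: j_def scarf_def field_simps power2_eq_square)
  moreover have "j * \<epsilon> + j\<^sup>2 * a \<le> scarf \<epsilon> a"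
    using j k by (intro scarf_ge_tangent \<epsilon>) auto
  moreover have "k\<^sup>2 * (a - \<zeta>) < j\<^sup>2 * (a - \<zeta>)"
    using j k less by (intro mult_strict_right_mono power_strict_mono) auto
  ultimately have "scarf \<epsilon> \<zeta> - k\<^sup>2 * \<zeta> < scarf \<epsilon> a - k\<^sup>2 * a"
    by (simp add: algebra_simps)
  then show ?thesis
    using False by (simp add: max_def)
qed

lemma newsvendor_solutions_2:
  assumes c: "0 < c" and cp: "c < p" and \<epsilon>: "0 < \<epsilon>"
  shows "newsvendor_solutions c p 2 \<epsilon> \<zeta> = {max 0 (- \<zeta> - \<epsilon> / 2 * sqrt (p / (p - c)))}"
proof -
  define k where "k = sqrt ((p - c) / p)"
  have k: "0 < k" "k < 1" and k2: "p * k\<^sup>2 = p - c"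
    using c cp by (auto simp: k_def)
  have "sqrt (p / (p - c)) = 1 / k"
    by (simp add: k_def real_sqrt_divide)
  then have x0: "max 0 (- \<zeta> - \<epsilon> / 2 * sqrt (p / (p - c))) + \<zeta> = max \<zeta> (- \<epsilon> / (2 * k))"
    by (simp add: max_def)
  have objective: "(c - p) * x + p * scarf \<epsilon> (x + \<zeta>)
      = p * (scarf \<epsilon> (x + \<zeta>) - k\<^sup>2 * (x + \<zeta>)) + (p - c) * \<zeta>" for x
  proof -
    have "p * (scarf \<epsilon> (x + \<zeta>) - k\<^sup>2 * (x + \<zeta>)) = p * scarf \<epsilon> (x + \<zeta>) - (p * k\<^sup>2) * (x + \<zeta>)"
      by (simp add: algebra_simps)
    then show ?thesis
      unfolding k2 by (simp add: algebra_simps)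
  qed
  show ?thesis
  proof (rule newsvendor_solutions_eq_singleton)
    show "newsvendor_objective c p 2 \<epsilon> \<zeta> x
        = ereal (p * (scarf \<epsilon> (x + \<zeta>) - k\<^sup>2 * (x + \<zeta>)) + (p - c) * \<zeta>)" for x
      using newsvendor_objective_2[of \<epsilon> p c \<zeta> x] objective[of x] c cp \<epsilon> by simp
  next
    fix x assume "0 \<le> x" and ne: "x \<noteq> max 0 (- \<zeta> - \<epsilon> / 2 * sqrt (p / (p - c)))"
    have "x + \<zeta> \<noteq> max \<zeta> (- \<epsilon> / (2 * k))"
      using ne x0 by linarith
    then show "p * (scarf \<epsilon> (max 0 (- \<zeta> - \<epsilon> / 2 * sqrt (p / (p - c))) + \<zeta>)
          - k\<^sup>2 * (max 0 (- \<zeta> - \<epsilon> / 2 * sqrt (p / (p - c))) + \<zeta>)) + (p - c) * \<zeta>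
        < p * (scarf \<epsilon> (x + \<zeta>) - k\<^sup>2 * (x + \<zeta>)) + (p - c) * \<zeta>"
      unfolding x0 using scarf_constrained_minimum[OF \<epsilon> k, of \<zeta> "x + \<zeta>"] \<open>0 \<le> x\<close> c cp by simp
  qed simp
qed

theorem proposition5:
  fixes c p \<zeta> \<epsilon> :: real
  assumes "0 < c" and "c < p" and "0 < \<epsilon>"
  shows "(\<zeta> \<le> 0 \<longrightarrow> newsvendor_solutions c p 1 \<epsilon> \<zeta> = {- \<zeta>}) \<and>
         newsvendor_solutions c p 2 \<epsilon> \<zeta> = {max 0 (- \<zeta> - \<epsilon> / 2 * sqrt (p / (p - c)))}"
  using assms newsvendor_solutions_1 newsvendor_solutions_2 by blast

end
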